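(* Let $\mathcal A$ be a nondeterministic discounted-sum ($\mathrm{DSum}$) automaton on finite or infinite words. Then Eve wins the one-token game $G_1(\mathcal A)$ if and only if $\mathcal A$ is history-deterministic, and winning strategies for Eve in $G_1(\mathcal A)$ induce winning strategies for Eve in the letter game on $\mathcal A$ of the same memory size.
   Context: **Automata.** A (nondeterministic quantitative) automaton is a tuple $\mathcal A=(\Sigma,Q,\iota,\delta)$ with $\Sigma$ a finite nonempty alphabet, $Q$ a finite nonempty set of states, $\iota\in Q$ the initial state, and $\delta:Q\times\Sigma\to 2^{\mathbb Q\times Q}$ a transition function whose values are finite and nonempty (the automaton is total). If $(x,q')\in\delta(q,\sigma)$ we write $q\xrightarrow{\sigma:x}q'$ for this transition, of weight $x$. A run on a finite or infinite word $w=\sigma_0\sigma_1\ldots$ is a sequence of transitions $q_0\xrightarrow{\sigma_0:x_0}q_1\xrightarrow{\sigma_1:x_1}\ldots$ with $q_0=\iota$. A $\mathrm{DSum}$ automaton is an automaton equipped, for some discount factor $\lambda\in\mathbb Q\cap(0,1)$, with the value function $\lambda\text{-}\mathrm{DSum}(v_0v_1\ldots)=\sum_{i\ge0}\lambda^iv_i$ on finite (resp. infinite) sequences. The value $\mathrm{Val}(\rho)$ of a run $\rho$ is the value function applied to its weight sequence, and $\mathcal A(w)$ is the supremum of the values of all runs of $\mathcal A$ on $w$. **Letter game and history-determinism.** A play of the letter game on $\mathcal A$ starts in $q_0=\iota$; in turn $i=0,1,\ldots$, from state $q_i$, Adam picks a letter $\sigma_i\in\Sigma$ and then Eve picks a transition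 $t_i=q_i\xrightarrow{\sigma_i:x_i}q_{i+1}$. This yields an infinite word $w=\sigma_0\sigma_1\ldots$ and an infinite sequence $\pi=t_0t_1\ldots$. For $\mathcal A$ on infinite words, Eve wins if $\mathrm{Val}(\pi)\ge\mathcal A(w)$. For $\mathcal A$ on finite words, Eve wins if for all $i\in\mathbb N$, $\mathrm{Val}(t_0\ldots t_i)\ge\mathcal A(\sigma_0\ldots\sigma_i)$. $\mathcal A$ is history-deterministic (HD) if Eve has a winning strategy in the letter game. **Token game $G_1(\mathcal A)$.** Configurations are pairs $(q,p)\in Q^2$, initially $(\iota,\iota)$. In turn $i$, from $(q_i,p_i)$: Adam picks a letter $\sigma_i\in\Sigma$; then Eve picks a transition $q_i\xrightarrow{\sigma_i:x_i}q_{i+1}$; then Adam picks a transition $p_i\xrightarrow{\sigma_i:y_i}p_{i+1}$. This yields two infinite runs, $\pi$ (Eve) and $\pi_1$ (Adam). On infinite words Eve wins if $\mathrm{Val}(\pi)\ge\mathrm{Val}(\pi_1)$; on finite words Eve wins if for every finite prefix of the play the value of Eve's run prefix is at least the value of Adam's run prefix. A player wins a game if they have a winning strategy in it. **Memory.** A strategy of Eve has memory of size $m$ if it is implemented by a set $M$ of $m$ memory states with an initial one, an update function that updates the memory state after each move as a function of the current memory state and the move made (including the current position), and a next-move function that chooses Eve's transition as a function of the current memory state and the current game position (in the letter game: Eve's current state and the letter just played; in $G_1$: the states of both tokens and the letter just played). *)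

theory Defs
  imports Complex_Main
begin

section \<open>Discounted-sum automata\<close>

datatype ('a, 'q) transition =
  Transition (src: 'q) (letter: 'a) (weight: rat) (tgt: 'q)

record ('a, 'q) dsum_automaton =
  alphabet :: "'a set"
  states   :: "'q set"
  init     :: 'q
  delta    :: "'q \<Rightarrow> 'a \<Rightarrow> (rat \<times> 'q) set"
  discount :: rat

definition wf_dsum_automaton :: "('a, 'q) dsum_automaton \<Rightarrow> bool" where
  "wf_dsum_automaton A \<longleftrightarrow>
     finite (alphabet A) \<and> alphabet A \<noteq> {} \<and>
     finite (states A) \<and> states A \<noteq> {} \<and> init A \<in> states A \<and>
     (\<forall>q\<in>states A. \<forall>a\<in>alphabet A.
        finite (delta A q a) \<and> delta A q a \<noteq> {} \<and> delta A q a \<subseteq> UNIV \<times> states A) \<and>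
     0 < discount A \<and> discount A < 1"

definition transitions :: "('a, 'q) dsum_automaton \<Rightarrow> ('a, 'q) transition set" where
  "transitions A =
     {t. src t \<in> states A \<and> letter t \<in> alphabet A \<and> (weight t, tgt t) \<in> delta A (src t) (letter t)}"

definition finite_run ::
  "('a, 'q) dsum_automaton \<Rightarrow> 'a list \<Rightarrow> ('a, 'q) transition list \<Rightarrow> bool" where
  "finite_run A w r \<longleftrightarrow>
     length r = length w \<and>
     (\<forall>i<length w. r ! i \<in> transitions A \<and> letter (r ! i) = w ! i \<and>
        src (r ! i) = (if i = 0 then init A else tgt (r ! (i - 1))))"

definition infinite_run ::
  "('a, 'q) dsum_automaton \<Rightarrow> (nat \<Rightarrow> 'a) \<Rightarrow> (nat \<Rightarrow> ('a, 'q) transition) \<Rightarrow> bool" where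
  "infinite_run A w r \<longleftrightarrow>
     (\<forall>i. r i \<in> transitions A \<and> letter (r i) = w i \<and>
        src (r i) = (if i = 0 then init A else tgt (r (i - 1))))"

definition val_finite ::
  "('a, 'q) dsum_automaton \<Rightarrow> ('a, 'q) transition list \<Rightarrow> real" where
  "val_finite A r = (\<Sum>i<length r. of_rat (discount A) ^ i * of_rat (weight (r ! i)))"

definition val_infinite ::
  "('a, 'q) dsum_automaton \<Rightarrow> (nat \<Rightarrow> ('a, 'q) transition) \<Rightarrow> real" where
  "val_infinite A r = (\<Sum>i. of_rat (discount A) ^ i * of_rat (weight (r i)))"

text \<open>
  A well-formed automaton has finitely many weights and is total, so the series above converges
  along every run, and the suprema below are over nonempty bounded sets of reals, for all words
  over the alphabet.
\<close>

definition value_finite :: "('a, 'q) dsum_automaton \<Rightarrow> 'a list \<Rightarrow> real" where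
  "value_finite A w = (SUP r\<in>{r. finite_run A w r}. val_finite A r)"

definition value_infinite :: "('a, 'q) dsum_automaton \<Rightarrow> (nat \<Rightarrow> 'a) \<Rightarrow> real" where
  "value_infinite A w = (SUP r\<in>{r. infinite_run A w r}. val_infinite A r)"

datatype word_kind = Finite_words | Infinite_words

definition prefix :: "nat \<Rightarrow> (nat \<Rightarrow> 'b) \<Rightarrow> 'b list" where
  "prefix n f = map f [0..<n]"

definition state_after :: "('a, 'q) dsum_automaton \<Rightarrow> ('a, 'q) transition list \<Rightarrow> 'q" where
  "state_after A r = (if r = [] then init A else tgt (last r))"

definition enabled :: "('a, 'q) dsum_automaton \<Rightarrow> 'q \<Rightarrow> 'a \<Rightarrow> ('a, 'q) transition set" where
  "enabled A q a = {t \<in> transitions A. src t = q \<and> letter t = a}"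


section \<open>The letter game\<close>

text \<open>
  A history of completed turns is the list of transitions chosen so far (each one records the
  letter it answers). A strategy maps such a history and the letter just played to a transition;
  its values on lists that are not histories of the game are irrelevant. It must choose an enabled
  transition after every history, including those that do not arise from the strategy itself.
\<close>

type_synonym ('a, 'q) letter_strategy =
  "('a, 'q) transition list \<Rightarrow> 'a \<Rightarrow> ('a, 'q) transition"

definition letter_history ::
  "('a, 'q) dsum_automaton \<Rightarrow> ('a, 'q) transition list \<Rightarrow> bool" where
  "letter_history A h \<longleftrightarrow> finite_run A (map letter h) h"

definition letter_strategy ::
  "('a, 'q) dsum_automaton \<Rightarrow> ('a, 'q) letter_strategy \<Rightarrow> bool" where
  "letter_strategy A s \<longleftrightarrow>
     (\<forall>h a. letter_history A h \<and> a \<in> alphabet A \<longrightarrow> s h a \<in> enabled A (state_after A h) a)"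

definition letter_play_won ::
  "word_kind \<Rightarrow> ('a, 'q) dsum_automaton \<Rightarrow> (nat \<Rightarrow> 'a) \<Rightarrow> (nat \<Rightarrow> ('a, 'q) transition) \<Rightarrow> bool" where
  "letter_play_won k A w r \<longleftrightarrow>
     (case k of
        Finite_words \<Rightarrow>
          \<forall>i. val_finite A (prefix (Suc i) r) \<ge> value_finite A (prefix (Suc i) w)
      | Infinite_words \<Rightarrow> val_infinite A r \<ge> value_infinite A w)"

definition letter_winning ::
  "word_kind \<Rightarrow> ('a, 'q) dsum_automaton \<Rightarrow> ('a, 'q) letter_strategy \<Rightarrow> bool" where
  "letter_winning k A s \<longleftrightarrow>
     letter_strategy A s \<and>
     (\<forall>w r. (\<forall>i. w i \<in> alphabet A) \<and> infinite_run A w r \<and> (\<forall>i. r i = s (prefix i r) (w i))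
        \<longrightarrow> letter_play_won k A w r)"

definition history_deterministic :: "word_kind \<Rightarrow> ('a, 'q) dsum_automaton \<Rightarrow> bool" where
  "history_deterministic k A \<longleftrightarrow> (\<exists>s. letter_winning k A s)"


section \<open>The one-token game\<close>

text \<open>A completed turn is the pair of Eve's and Adam's transitions.\<close>

type_synonym ('a, 'q) G1_strategy =
  "(('a, 'q) transition \<times> ('a, 'q) transition) list \<Rightarrow> 'a \<Rightarrow> ('a, 'q) transition"

definition G1_history ::
  "('a, 'q) dsum_automaton \<Rightarrow> (('a, 'q) transition \<times> ('a, 'q) transition) list \<Rightarrow> bool" where
  "G1_history A h \<longleftrightarrow> (\<exists>w. finite_run A w (map fst h) \<and> finite_run A w (map snd h))"

definition G1_strategy ::
  "('a, 'q) dsum_automaton \<Rightarrow> ('a, 'q) G1_strategy \<Rightarrow> bool" where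
  "G1_strategy A s \<longleftrightarrow>
     (\<forall>h a. G1_history A h \<and> a \<in> alphabet A \<longrightarrow>
        s h a \<in> enabled A (state_after A (map fst h)) a)"

definition G1_play_won ::
  "word_kind \<Rightarrow> ('a, 'q) dsum_automaton \<Rightarrow>
   (nat \<Rightarrow> ('a, 'q) transition) \<Rightarrow> (nat \<Rightarrow> ('a, 'q) transition) \<Rightarrow> bool" where
  "G1_play_won k A r r1 \<longleftrightarrow>
     (case k of
        Finite_words \<Rightarrow> \<forall>n. val_finite A (prefix n r) \<ge> val_finite A (prefix n r1)
      | Infinite_words \<Rightarrow> val_infinite A r \<ge> val_infinite A r1)"

definition G1_winning ::
  "word_kind \<Rightarrow> ('a, 'q) dsum_automaton \<Rightarrow> ('a, 'q) G1_strategy \<Rightarrow> bool" where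
  "G1_winning k A s \<longleftrightarrow>
     G1_strategy A s \<and>
     (\<forall>w r r1. (\<forall>i. w i \<in> alphabet A) \<and> infinite_run A w r \<and> infinite_run A w r1 \<and>
        (\<forall>i. r i = s (prefix i (\<lambda>j. (r j, r1 j))) (w i))
        \<longrightarrow> G1_play_won k A r r1)"

definition eve_wins_G1 :: "word_kind \<Rightarrow> ('a, 'q) dsum_automaton \<Rightarrow> bool" where
  "eve_wins_G1 k A \<longleftrightarrow> (\<exists>s. G1_winning k A s)"


section \<open>Memory\<close>

text \<open>
  A move carries the position in which it is made. A transition already contains the state it
  leaves and the letter it reads; the additional argument of \<open>G1_Eve\<close> is the state of Adam's
  token, and that of \<open>G1_Adam\<close> is the state of Eve's token, which has already moved in this turn.
\<close>

datatype ('a, 'q) letter_move =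
    L_Adam 'q 'a
  | L_Eve "('a, 'q) transition"

fun letter_turn_moves :: "('a, 'q) transition \<Rightarrow> ('a, 'q) letter_move list" where
  "letter_turn_moves t = [L_Adam (src t) (letter t), L_Eve t]"

datatype ('a, 'q) G1_move =
    G1_Letter 'q 'q 'a
  | G1_Eve 'q "('a, 'q) transition"
  | G1_Adam 'q "('a, 'q) transition"

fun G1_turn_moves ::
  "('a, 'q) transition \<times> ('a, 'q) transition \<Rightarrow> ('a, 'q) G1_move list" where
  "G1_turn_moves (t, t1) =
     [G1_Letter (src t) (src t1) (letter t), G1_Eve (src t1) t, G1_Adam (tgt t) t1]"

text \<open>
  The strategy is implemented with \<open>M\<close> as its set of memory states, so its memory has size \<open>|M|\<close>;
  \<open>M\<close> may be infinite.
\<close>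

definition letter_memory ::
  "('a, 'q) dsum_automaton \<Rightarrow> ('a, 'q) letter_strategy \<Rightarrow> 'm set \<Rightarrow> bool" where
  "letter_memory A s M \<longleftrightarrow>
     (\<exists>(m0 :: 'm) (upd :: 'm \<Rightarrow> ('a, 'q) letter_move \<Rightarrow> 'm)
        (nxt :: 'm \<Rightarrow> 'q \<Rightarrow> 'a \<Rightarrow> ('a, 'q) transition).
        m0 \<in> M \<and> (\<forall>m\<in>M. \<forall>v. upd m v \<in> M) \<and>
        (\<forall>h a. letter_history A h \<and> a \<in> alphabet A \<longrightarrow>
           (let q = state_after A h;
                m = foldl upd m0 (concat (map letter_turn_moves h) @ [L_Adam q a])
            in s h a = nxt m q a)))"

definition G1_memory ::
  "('a, 'q) dsum_automaton \<Rightarrow> ('a, 'q) G1_strategy \<Rightarrow> 'm set \<Rightarrow> bool" where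
  "G1_memory A s M \<longleftrightarrow>
     (\<exists>(m0 :: 'm) (upd :: 'm \<Rightarrow> ('a, 'q) G1_move \<Rightarrow> 'm)
        (nxt :: 'm \<Rightarrow> 'q \<times> 'q \<Rightarrow> 'a \<Rightarrow> ('a, 'q) transition).
        m0 \<in> M \<and> (\<forall>m\<in>M. \<forall>v. upd m v \<in> M) \<and>
        (\<forall>h a. G1_history A h \<and> a \<in> alphabet A \<longrightarrow>
           (let q = state_after A (map fst h);
                p = state_after A (map snd h);
                m = foldl upd m0 (concat (map G1_turn_moves h) @ [G1_Letter q p a])
            in s h a = nxt m (q, p) a)))"

end

theory Submission
  imports Defs
begin

text \<open>
  Against an opponent that copies her moves, a strategy \<open>s\<close> winning \<open>G\<^sub>1\<close> is a strategy in the
  letter game. Let \<open>\<pi>\<close> be its run on \<open>w\<close>. If Adam plays in \<open>G\<^sub>1\<close> a run \<open>\<rho>\<close> on \<open>w\<close> that agrees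
  with \<open>\<pi>\<close> in the first \<open>n\<close> turns, then the answer of \<open>s\<close> agrees with \<open>\<pi>\<close> in the first \<open>n + 1\<close>
  turns, as it depends on the completed turns only, and its value is at least that of \<open>\<rho>\<close>.
  Iterating, for every \<open>n\<close> each run on \<open>w\<close> is dominated by one agreeing with \<open>\<pi>\<close> in the first
  \<open>n\<close> turns. For finite words this is the claim; for infinite words the value of such a run
  differs from that of \<open>\<pi>\<close> by \<open>O(\<lambda>\<^sup>n)\<close>. Conversely, a strategy winning the letter game wins
  \<open>G\<^sub>1\<close> by ignoring Adam's token.
\<close>

section \<open>Prefixes and runs\<close>

lemma length_prefix [simp]: "length (prefix n f) = n"
  by (simp add: prefix_def)

lemma nth_prefix [simp]: "i < n \<Longrightarrow> prefix n f ! i = f i"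
  by (simp add: prefix_def)

lemma prefix_0 [simp]: "prefix 0 f = []"
  by (simp add: prefix_def)

lemma prefix_Suc: "prefix (Suc n) f = prefix n f @ [f n]"
  by (simp add: prefix_def)

lemma map_prefix: "map g (prefix n f) = prefix n (\<lambda>i. g (f i))"
  by (simp add: prefix_def)

lemma prefix_cong: "(\<And>i. i < n \<Longrightarrow> f i = g i) \<Longrightarrow> prefix n f = prefix n g"
  by (simp add: prefix_def)

lemma zip_prefix: "zip (prefix n f) (prefix n g) = prefix n (\<lambda>i. (f i, g i))"
  by (simp add: list_eq_iff_nth_eq)

lemma state_after_prefix:
  "state_after A (prefix i r) = (if i = 0 then init A else tgt (r (i - 1)))"
  by (cases i) (simp_all add: state_after_def prefix_Suc)

lemma finite_run_Nil [simp]: "finite_run A [] []"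
  by (simp add: finite_run_def)

lemma finite_run_snoc:
  assumes "finite_run A w h" and "t \<in> enabled A (state_after A h) a"
  shows "finite_run A (w @ [a]) (h @ [t])"
  using assms unfolding finite_run_def enabled_def
  by (auto simp: nth_append less_Suc_eq state_after_def last_conv_nth)

lemma finite_run_nth_enabled:
  assumes "finite_run A w h" and "i < length w"
  shows "h ! i \<in> enabled A (state_after A (take i h)) (w ! i)"
proof -
  have "state_after A (take i h) = (if i = 0 then init A else tgt (h ! (i - 1)))"
    using assms by (cases i) (auto simp: state_after_def finite_run_def take_Suc_conv_app_nth)
  then show ?thesis
    using assms unfolding finite_run_def enabled_def by simp
qed

lemma infinite_run_iff_enabled:
  "infinite_run A w r \<longleftrightarrow> (\<forall>i. r i \<in> enabled A (state_after A (prefix i r)) (w i))"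
  unfolding infinite_run_def enabled_def state_after_prefix by auto

lemma finite_run_prefix:
  assumes "infinite_run A w r"
  shows "finite_run A (prefix n w) (prefix n r)"
  using assms unfolding infinite_run_def finite_run_def by auto

lemma finite_run_letters: "finite_run A w h \<Longrightarrow> map letter h = w"
  unfolding finite_run_def by (auto intro: nth_equalityI)

lemma state_after_in_states:
  assumes "wf_dsum_automaton A" and "finite_run A w h"
  shows "state_after A h \<in> states A"
proof (cases "h = []")
  case True
  then show ?thesis using assms by (simp add: state_after_def wf_dsum_automaton_def)
next
  case False
  then have "last h \<in> transitions A"
    using assms(2) unfolding finite_run_def
    by (metis last_conv_nth length_greater_0_conv diff_less zero_less_one)
  with assms(1) have "tgt (last h) \<in> states A"
    unfolding transitions_def wf_dsum_automaton_def by blast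
  with False show ?thesis by (simp add: state_after_def)
qed

lemma enabled_nonempty:
  assumes "wf_dsum_automaton A" and "q \<in> states A" and "a \<in> alphabet A"
  shows "enabled A q a \<noteq> {}"
proof -
  obtain x p where "(x, p) \<in> delta A q a"
    using assms unfolding wf_dsum_automaton_def by (metis ex_in_conv surj_pair)
  with assms have "Transition q a x p \<in> enabled A q a"
    by (simp add: enabled_def transitions_def)
  then show ?thesis by blast
qed

text \<open>Plays out a choice function along a fixed word. The letter to be read is determined by
  the length of the history, so \<open>f\<close> takes the history alone; it has to be legal only on
  runs over prefixes of \<open>w\<close>, the only histories that occur.\<close>

lemma consistent_run_exists:
  assumes enabled: "\<And>h. finite_run A (prefix (length h) w) h \<Longrightarrow>
      f h \<in> enabled A (state_after A h) (w (length h))"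
  obtains r where "infinite_run A w r" and "\<And>i. r i = f (prefix i r)"
proof -
  \<comment> \<open>\<open>H i\<close> is the history after \<open>i\<close> turns. Recursion on
    histories replaces the circular description of \<open>r\<close> by its own prefixes.\<close>
  define H where "H = rec_nat [] (\<lambda>_ h. h @ [f h])"
  define r where "r = (\<lambda>i. f (H i))"
  have H: "H i = prefix i r" for i
    by (induction i) (simp_all add: H_def r_def prefix_Suc)
  have r: "r i = f (prefix i r)" for i
    unfolding H[symmetric] by (simp add: r_def)
  have fin: "finite_run A (prefix i w) (prefix i r)" for i
  proof (induction i)
    case (Suc i)
    have "r i \<in> enabled A (state_after A (prefix i r)) (w i)"
      using enabled[of "prefix i r"] Suc r[of i] by simp
    then show ?case using finite_run_snoc[OF Suc] by (simp add: prefix_Suc)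
  qed simp
  have "infinite_run A w r"
    unfolding infinite_run_iff_enabled
  proof
    fix i
    show "r i \<in> enabled A (state_after A (prefix i r)) (w i)"
      using enabled[of "prefix i r"] fin[of i] r[of i] by simp
  qed
  then show thesis using that r by blast
qed

text \<open>Rests on totality of the automaton. It turns a run on a finite word into a move sequence
  for Adam in \<open>G1\<close>, whose plays are infinite.\<close>

lemma finite_run_extends:
  assumes wf: "wf_dsum_automaton A" and w: "\<And>i. w i \<in> alphabet A"
    and run: "finite_run A (prefix n w) h"
  obtains r where "infinite_run A w r" and "prefix n r = h"
proof -
  \<comment> \<open>Copies \<open>h\<close> as long as the history is a proper prefix of
    \<open>h\<close>, and otherwise takes any enabled transition, so that \<open>f\<close> is legal
    also on histories that leave \<open>h\<close>.\<close>
  define f where "f = (\<lambda>g. if length g < n \<and> g = take (length g) h then h ! length g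
    else SOME t. t \<in> enabled A (state_after A g) (w (length g)))"
  have "f g \<in> enabled A (state_after A g) (w (length g))"
    if g: "finite_run A (prefix (length g) w) g" for g
  proof (cases "length g < n \<and> g = take (length g) h")
    case True
    then show ?thesis using finite_run_nth_enabled[OF run, of "length g"] by (simp add: f_def)
  next
    case False
    have "enabled A (state_after A g) (w (length g)) \<noteq> {}"
      using enabled_nonempty[OF wf state_after_in_states[OF wf g] w] .
    then show ?thesis using False unfolding f_def by (auto intro: someI)
  qed
  then obtain r where r: "infinite_run A w r" "\<And>i. r i = f (prefix i r)"
    using consistent_run_exists by metis
  have len: "length h = n" using run by (simp add: finite_run_def)
  have "prefix i r = take i h" if "i \<le> n" for i
    using that
  proof (induction i)
    case (Suc i)
    then have "r i = h ! i" using r(2)[of i] len by (simp add: f_def)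
    then show ?case using Suc len by (simp add: prefix_Suc take_Suc_conv_app_nth)
  qed simp
  then have "prefix n r = h" using len by simp
  with r(1) show thesis using that by blast
qed

section \<open>Bounds on values of runs\<close>

lemma finite_transitions:
  assumes "wf_dsum_automaton A"
  shows "finite (transitions A)"
proof (rule finite_subset)
  let ?S = "SIGMA q:states A. SIGMA a:alphabet A. delta A q a"
  show "transitions A \<subseteq> (\<lambda>(q, a, x, p). Transition q a x p) ` ?S"
  proof
    fix t assume "t \<in> transitions A"
    then show "t \<in> (\<lambda>(q, a, x, p). Transition q a x p) ` ?S"
      by (cases t) (force simp: transitions_def)
  qed
  show "finite ((\<lambda>(q, a, x, p). Transition q a x p) ` ?S)"
    using assms unfolding wf_dsum_automaton_def by (intro finite_imageI finite_SigmaI) auto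
qed

lemma weights_bounded:
  assumes "wf_dsum_automaton A"
  obtains W :: real where "\<And>t. t \<in> transitions A \<Longrightarrow> \<bar>of_rat (weight t)\<bar> \<le> W"
proof
  let ?S = "(\<lambda>t. \<bar>of_rat (weight t)\<bar> :: real) ` transitions A"
  have fin: "finite ?S" using finite_transitions[OF assms] by simp
  show "\<bar>of_rat (weight t)\<bar> \<le> Max (insert 0 ?S)" if "t \<in> transitions A" for t
    using fin that by (intro Max_ge) auto
qed

lemma discount_bounds:
  assumes "wf_dsum_automaton A"
  shows "0 < (of_rat (discount A) :: real)" and "(of_rat (discount A) :: real) < 1"
  using assms unfolding wf_dsum_automaton_def by simp_all

lemma val_finite_prefix:
  "val_finite A (prefix n r) = (\<Sum>i<n. of_rat (discount A) ^ i * of_rat (weight (r i)))"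
  by (simp add: val_finite_def)

text \<open>The weights from turn \<open>n\<close> on are dominated by a geometric series with first
  term \<open>W * ?l ^ n\<close> and ratio \<open>?l\<close>.\<close>

lemma val_infinite_tail_bound:
  assumes wf: "wf_dsum_automaton A"
    and W: "\<And>t. t \<in> transitions A \<Longrightarrow> \<bar>of_rat (weight t)\<bar> \<le> (W :: real)"
    and run: "infinite_run A w r"
  shows "\<bar>val_infinite A r - val_finite A (prefix n r)\<bar>
    \<le> W * of_rat (discount A) ^ n / (1 - of_rat (discount A))"
proof -
  let ?l = "of_rat (discount A) :: real"
  let ?f = "\<lambda>i. ?l ^ i * of_rat (weight (r i)) :: real"
  have l: "0 < ?l" "?l < 1" using discount_bounds[OF wf] .
  have W': "\<bar>of_rat (weight (r i))\<bar> \<le> W" for i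
    using W run unfolding infinite_run_def by blast
  have bound: "norm (?f i) \<le> ?l ^ i * W" for i
    using W'[of i] l by (simp add: abs_mult mult_left_mono)
  have geo: "summable (\<lambda>i. ?l ^ i * W)"
    using l by (intro summable_mult2 summable_geometric) simp
  have sm: "summable ?f" using geo bound by (rule summable_comparison_test')
  have geo_n: "(\<lambda>i. ?l ^ (i + n) * W) sums (W * ?l ^ n / (1 - ?l))"
    using sums_mult[OF geometric_sums[of ?l], of "W * ?l ^ n"] l
    by (simp add: power_add mult_ac)
  have "val_infinite A r - val_finite A (prefix n r) = (\<Sum>i. ?f (i + n))"
    using suminf_split_initial_segment[OF sm, of n]
    by (simp add: val_infinite_def val_finite_prefix)
  moreover have "norm (\<Sum>i. ?f (i + n)) \<le> (\<Sum>i. ?l ^ (i + n) * W)"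
    using bound sums_summable[OF geo_n] by (intro norm_suminf_le) auto
  ultimately show ?thesis using sums_unique[OF geo_n] by simp
qed

text \<open>The reals are only conditionally complete, so the content is boundedness of the values:
  every weight is at most \<open>W\<close>, and the powers of the discount factor are
  positive.\<close>

lemma val_finite_le_value_finite:
  assumes wf: "wf_dsum_automaton A" and run: "finite_run A w h"
  shows "val_finite A h \<le> value_finite A w"
  unfolding value_finite_def
proof (rule cSUP_upper)
  obtain W :: real where W: "\<And>t. t \<in> transitions A \<Longrightarrow> \<bar>of_rat (weight t)\<bar> \<le> W"
    using weights_bounded[OF wf] by metis
  have "val_finite A r \<le> (\<Sum>i<length w. of_rat (discount A) ^ i * W)" if "finite_run A w r" for r
  proof -
    have "of_rat (weight (r ! i)) \<le> W" if "i < length w" for i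
      using W[of "r ! i"] \<open>finite_run A w r\<close> that
      unfolding finite_run_def by (metis abs_le_D1)
    then show ?thesis
      using that discount_bounds[OF wf] unfolding val_finite_def finite_run_def
      by (auto intro!: sum_mono mult_left_mono)
  qed
  then show "bdd_above (val_finite A ` {r. finite_run A w r})"
    by (intro bdd_aboveI2[where M = "\<Sum>i<length w. of_rat (discount A) ^ i * W"]) simp
qed (use run in simp)

lemma val_infinite_le_value_infinite:
  assumes wf: "wf_dsum_automaton A" and run: "infinite_run A w r"
  shows "val_infinite A r \<le> value_infinite A w"
  unfolding value_infinite_def
proof (rule cSUP_upper)
  obtain W :: real where W: "\<And>t. t \<in> transitions A \<Longrightarrow> \<bar>of_rat (weight t)\<bar> \<le> W"
    using weights_bounded[OF wf] by metis
  \<comment> \<open>For \<open>n = 0\<close> the prefix is empty and has value 0, so the tail bound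
    applies to the whole value.\<close>
  have "val_infinite A r \<le> W / (1 - of_rat (discount A))" if "infinite_run A w r" for r
    using val_infinite_tail_bound[OF wf W that, of 0] by (simp add: val_finite_def)
  then show "bdd_above (val_infinite A ` {r. infinite_run A w r})"
    by (intro bdd_aboveI2[where M = "W / (1 - of_rat (discount A))"]) simp
qed (use run in simp)

text \<open>\<open>r\<close> and \<open>r'\<close> share their first \<open>n\<close> turns, hence
  both values lie within one tail bound of the same finite sum. This gives the factor 2; the error
  vanishes as \<open>n\<close> grows.\<close>

lemma val_infinite_le_if_dominated:
  assumes wf: "wf_dsum_automaton A" and run: "infinite_run A w r"
    and dom: "\<And>n. \<exists>r'. infinite_run A w r' \<and> prefix n r' = prefix n r \<and> v \<le> val_infinite A r'"
  shows "v \<le> val_infinite A r"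
proof -
  let ?l = "of_rat (discount A) :: real"
  obtain W :: real where W: "\<And>t. t \<in> transitions A \<Longrightarrow> \<bar>of_rat (weight t)\<bar> \<le> W"
    using weights_bounded[OF wf] by metis
  have "v \<le> val_infinite A r + 2 * (W * ?l ^ n / (1 - ?l))" for n
  proof -
    obtain r' where r': "infinite_run A w r'" "prefix n r' = prefix n r" "v \<le> val_infinite A r'"
      using dom by blast
    show ?thesis
      using val_infinite_tail_bound[OF wf W run, of n] val_infinite_tail_bound[OF wf W r'(1), of n]
        r'(2,3) by (simp add: abs_le_iff)
  qed
  moreover have "(\<lambda>n. val_infinite A r + 2 * (W * ?l ^ n / (1 - ?l)))
      \<longlonglongrightarrow> val_infinite A r + 2 * (W * 0 / (1 - ?l))"
    using discount_bounds[OF wf] by (intro tendsto_intros LIMSEQ_realpow_zero) auto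
  ultimately show ?thesis
    by (intro LIMSEQ_le_const[where a = v and x = "val_infinite A r"]) auto
qed

section \<open>From the letter game to the one-token game\<close>

lemma letter_winning_imp_eve_wins_G1:
  assumes wf: "wf_dsum_automaton A" and win: "letter_winning k A s"
  shows "eve_wins_G1 k A"
proof -
  define s1 :: "('a, 'b) G1_strategy" where "s1 = (\<lambda>h. s (map fst h))"
  \<comment> \<open>A \<open>G1_history\<close> has some common word, while a
    \<open>letter_history\<close> reads its word off the transitions;
    \<open>finite_run_letters\<close> identifies the two.\<close>
  have "letter_history A (map fst h)" if "G1_history A h"
    for h :: "(('a, 'b) transition \<times> ('a, 'b) transition) list"
    using that finite_run_letters unfolding G1_history_def letter_history_def by fastforce
  then have "G1_strategy A s1"
    using win unfolding G1_strategy_def letter_winning_def letter_strategy_def s1_def by blast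
  moreover have "G1_play_won k A r r1"
    if w: "\<forall>i. w i \<in> alphabet A" and r: "infinite_run A w r" and r1: "infinite_run A w r1"
      and s: "\<forall>i. r i = s1 (prefix i (\<lambda>j. (r j, r1 j))) (w i)" for w r r1
  proof -
    have "r i = s (prefix i r) (w i)" for i
      using spec[OF s, of i] by (simp add: s1_def map_prefix)
    then have won: "letter_play_won k A w r"
      using win w r unfolding letter_winning_def by blast
    show ?thesis
    proof (cases k)
      case Finite_words
      \<comment> \<open>The letter game compares nonempty prefixes only. For \<open>n = 0\<close>
        both values are 0.\<close>
      have "val_finite A (prefix n r1) \<le> val_finite A (prefix n r)" for n
      proof (cases n)
        case (Suc i)
        have "val_finite A (prefix n r1) \<le> value_finite A (prefix n w)"
          using val_finite_le_value_finite[OF wf finite_run_prefix[OF r1]] .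
        also have "\<dots> \<le> val_finite A (prefix n r)"
          using won Finite_words Suc by (simp add: letter_play_won_def)
        finally show ?thesis .
      qed simp
      then show ?thesis using Finite_words by (simp add: G1_play_won_def)
    next
      case Infinite_words
      then show ?thesis
        using won val_infinite_le_value_infinite[OF wf r1]
        by (simp add: G1_play_won_def letter_play_won_def)
    qed
  qed
  ultimately have "G1_winning k A s1" unfolding G1_winning_def by blast
  then show ?thesis unfolding eve_wins_G1_def by blast
qed

section \<open>From the one-token game to the letter game\<close>

definition mirror_strategy :: "('a, 'q) G1_strategy \<Rightarrow> ('a, 'q) letter_strategy" where
  "mirror_strategy s h = s (map (\<lambda>t. (t, t)) h)"

lemma G1_history_mirror: "letter_history A h \<Longrightarrow> G1_history A (map (\<lambda>t. (t, t)) h)"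
  unfolding letter_history_def G1_history_def by (auto simp: comp_def)

text \<open>Adam may fix his whole run in advance: in each turn \<open>s\<close> is shown only as
  much of \<open>r1\<close> as has been played.\<close>

lemma G1_response:
  assumes win: "G1_winning k A s" and w: "\<And>i. w i \<in> alphabet A" and r1: "infinite_run A w r1"
  obtains r where "infinite_run A w r" and "G1_play_won k A r r1"
    and "\<And>i. r i = s (prefix i (\<lambda>j. (r j, r1 j))) (w i)"
proof -
  define f where "f = (\<lambda>h. s (zip h (prefix (length h) r1)) (w (length h)))"
  have "f h \<in> enabled A (state_after A h) (w (length h))"
    if h: "finite_run A (prefix (length h) w) h" for h
  proof -
    have "G1_history A (zip h (prefix (length h) r1))"
      unfolding G1_history_def using h finite_run_prefix[OF r1] by auto
    then show ?thesis
      using win w unfolding G1_winning_def G1_strategy_def f_def by fastforce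
  qed
  then obtain r where r: "infinite_run A w r" "\<And>i. r i = f (prefix i r)"
    using consistent_run_exists by metis
  have "r i = s (prefix i (\<lambda>j. (r j, r1 j))) (w i)" for i
    using r(2)[of i] by (simp add: f_def zip_prefix)
  with r(1) show thesis
    using that win w r1 unfolding G1_winning_def by blast
qed

lemma G1_response_agrees:
  assumes r: "\<And>i. r i = s (prefix i (\<lambda>j. (r j, r1 j))) (w i)"
    and p: "\<And>i. p i = mirror_strategy s (prefix i p) (w i)"
    and agree: "prefix n r1 = prefix n p"
  shows "prefix (Suc n) r = prefix (Suc n) p"
proof -
  have r1: "r1 i = p i" if "i < n" for i
    using arg_cong[OF agree, of "\<lambda>l. l ! i"] that by simp
  \<comment> \<open>Turn \<open>i\<close> consults only the pairs of turns before \<open>i\<close>.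
    Hence turn \<open>n\<close> still sees a mirrored history although \<open>r1\<close> may differ
    from \<open>p\<close> there, which gains one turn.\<close>
  have "r i = p i" if "i \<le> n" for i
    using that
  proof (induction i rule: less_induct)
    case (less i)
    then have "prefix i (\<lambda>j. (r j, r1 j)) = map (\<lambda>t. (t, t)) (prefix i p)"
      unfolding map_prefix by (intro prefix_cong) (simp add: r1)
    then show ?case using r[of i] p[of i] by (simp add: mirror_strategy_def)
  qed
  then show ?thesis by (intro prefix_cong) simp
qed

lemma G1_play_won_trans:
  "G1_play_won k A r2 r1 \<Longrightarrow> G1_play_won k A r1 r \<Longrightarrow> G1_play_won k A r2 r"
  unfolding G1_play_won_def by (cases k) (auto intro: order_trans)

text \<open>Start from \<open>r\<close> and let \<open>s\<close> respond \<open>n\<close> times,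
  each time to its previous response. Every response beats its predecessor and agrees with
  \<open>p\<close> one turn longer.\<close>

lemma dominating_run_agreeing_with_mirror:
  assumes win: "G1_winning k A s" and w: "\<And>i. w i \<in> alphabet A" and r: "infinite_run A w r"
    and p: "\<And>i. p i = mirror_strategy s (prefix i p) (w i)"
  shows "\<exists>r'. infinite_run A w r' \<and> prefix n r' = prefix n p \<and> G1_play_won k A r' r"
proof (induction n)
  case 0
  have "G1_play_won k A r r" by (cases k) (simp_all add: G1_play_won_def)
  then show ?case using r by auto
next
  case (Suc n)
  then obtain r1 where r1: "infinite_run A w r1" "prefix n r1 = prefix n p" "G1_play_won k A r1 r"
    by blast
  obtain r2 where r2: "infinite_run A w r2" "G1_play_won k A r2 r1"
      "\<And>i. r2 i = s (prefix i (\<lambda>j. (r2 j, r1 j))) (w i)"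
    using G1_response[OF win w r1(1)] by metis
  then show ?case
    using G1_response_agrees[OF r2(3) p r1(2)] G1_play_won_trans[OF r2(2) r1(3)] by blast
qed

lemma letter_winning_mirror:
  assumes wf: "wf_dsum_automaton A" and win: "G1_winning k A s"
  shows "letter_winning k A (mirror_strategy s)"
  unfolding letter_winning_def
proof (intro conjI allI impI; (elim conjE)?)
  show "letter_strategy A (mirror_strategy s)"
    unfolding letter_strategy_def
  proof (intro allI impI; elim conjE)
    fix h a assume "letter_history A h" "a \<in> alphabet A"
    then show "mirror_strategy s h a \<in> enabled A (state_after A h) a"
      using win G1_history_mirror[of A h]
      unfolding G1_winning_def G1_strategy_def mirror_strategy_def
      by (fastforce simp: comp_def)
  qed
next
  fix w p
  assume "\<forall>i. w i \<in> alphabet A" and run: "infinite_run A w p"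
    and "\<forall>i. p i = mirror_strategy s (prefix i p) (w i)"
  then have w: "w i \<in> alphabet A" and p: "p i = mirror_strategy s (prefix i p) (w i)" for i
    by blast+
  note dominating = dominating_run_agreeing_with_mirror[OF win w _ p]
  show "letter_play_won k A w p"
  proof (cases k)
    case Finite_words
    have "value_finite A (prefix n w) \<le> val_finite A (prefix n p)" for n
      unfolding value_finite_def
    proof (rule cSUP_least)
      show "{r. finite_run A (prefix n w) r} \<noteq> {}" using finite_run_prefix[OF run] by blast
      fix h assume "h \<in> {r. finite_run A (prefix n w) r}"
      then obtain r where r: "infinite_run A w r" "prefix n r = h"
        using finite_run_extends[of A w, OF wf w] by blast
      \<comment> \<open>The dominating run has the same first \<open>n\<close> turns as
        \<open>p\<close>, so comparing prefixes of length \<open>n\<close> is exact and takes no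
        limit.\<close>
      then show "val_finite A h \<le> val_finite A (prefix n p)"
        using dominating[OF r(1), of n] Finite_words
        by (metis G1_play_won_def word_kind.simps(3))
    qed
    then show ?thesis using Finite_words by (simp add: letter_play_won_def)
  next
    case Infinite_words
    have "value_infinite A w \<le> val_infinite A p"
      unfolding value_infinite_def
    proof (rule cSUP_least)
      show "{r. infinite_run A w r} \<noteq> {}" using run by blast
      fix r assume "r \<in> {r. infinite_run A w r}"
      \<comment> \<open>The dominating run changes with \<open>n\<close>, so here the limit argument
        is needed.\<close>
      then have "\<exists>r'. infinite_run A w r' \<and> prefix n r' = prefix n p
          \<and> val_infinite A r \<le> val_infinite A r'" for n
        using dominating[of r n] Infinite_words by (simp add: G1_play_won_def)
      then show "val_infinite A r \<le> val_infinite A p"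
        by (rule val_infinite_le_if_dominated[OF wf run])
    qed
    then show ?thesis using Infinite_words by (simp add: letter_play_won_def)
  qed
qed

section \<open>Preservation of the memory set\<close>

lemma letter_memory_mirror:
  fixes M :: "'m set"
  assumes "G1_memory A s M"
  shows "letter_memory A (mirror_strategy s) M"
proof -
  obtain m0 :: 'm and upd nxt where m0: "m0 \<in> M" and upd: "\<And>m v. m \<in> M \<Longrightarrow> upd m v \<in> M"
    and s: "\<And>h a. G1_history A h \<Longrightarrow> a \<in> alphabet A \<Longrightarrow>
      s h a = nxt (foldl upd m0 (concat (map G1_turn_moves h) @
          [G1_Letter (state_after A (map fst h)) (state_after A (map snd h)) a]))
        (state_after A (map fst h), state_after A (map snd h)) a"
    using assms unfolding G1_memory_def Let_def by blast
  \<comment> \<open>Both tokens are always in the same state, so the letter game position determines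
    the \<open>G1\<close> position. Eve's move triggers two updates, her own and Adam's copy of it;
    the intermediate memory state also stays in \<open>M\<close>.\<close>
  define upd' where "upd' = (\<lambda>m v. case v of
      L_Adam q a \<Rightarrow> upd m (G1_Letter q q a)
    | L_Eve t \<Rightarrow> upd (upd m (G1_Eve (src t) t)) (G1_Adam (tgt t) t))"
  have fold: "foldl upd' m (concat (map letter_turn_moves h)) =
      foldl upd m (concat (map G1_turn_moves (map (\<lambda>t. (t, t)) h)))" for m h
    by (induction h arbitrary: m) (simp_all add: upd'_def)
  have "mirror_strategy s h a = nxt (foldl upd' m0 (concat (map letter_turn_moves h) @
      [L_Adam (state_after A h) a])) (state_after A h, state_after A h) a"
    if "letter_history A h" "a \<in> alphabet A" for h a
    using s[OF G1_history_mirror[OF that(1)] that(2)]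
    by (simp add: mirror_strategy_def fold comp_def) (simp add: upd'_def)
  moreover have "\<forall>m\<in>M. \<forall>v. upd' m v \<in> M"
    using upd by (simp add: upd'_def split: letter_move.split)
  ultimately show ?thesis
    unfolding letter_memory_def Let_def
    by (intro exI[of _ m0] exI[of _ upd'] exI[of _ "\<lambda>m q. nxt m (q, q)"]) (use m0 in blast)
qed

theorem corollary4p3:
  fixes A :: "('a, 'q) dsum_automaton" and k :: word_kind
  assumes "wf_dsum_automaton A"
  shows "(eve_wins_G1 k A \<longleftrightarrow> history_deterministic k A) \<and>
         (\<forall>(s :: ('a, 'q) G1_strategy) (M :: 'm set).
            G1_winning k A s \<and> G1_memory A s M \<longrightarrow>
            (\<exists>s' :: ('a, 'q) letter_strategy. letter_winning k A s' \<and> letter_memory A s' M))"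
  using letter_winning_imp_eve_wins_G1[OF assms] letter_winning_mirror[OF assms]
    letter_memory_mirror
  unfolding eve_wins_G1_def history_deterministic_def by blast

end
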